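(* Let $P$ be the transition matrix of an ergodic discrete-time Markov chain on the finite state set $\{1,\dots,n\}$, with equilibrium distribution $w$, Laplacian $\Delta^{ij}=w^i(\delta_{ij}-P_i{}^j)$, and matrix $Z_{ij}$ as defined in the context. Then the quadratic form $$\|x\|^2=\sum_{i,j}x_i\,\Delta^{ij}\,x_j,\qquad x\in\mathbb{R}^n,$$ descends to a well-defined, strictly positive definite quadratic form on the quotient space $\mathbb{R}^n/\mathbb{R}(1,\dots,1)$ (making it a Euclidean space), and the map $$f:\{1,\dots,n\}\to\mathbb{R}^n/\mathbb{R}(1,\dots,1),\qquad f(a)=\text{class of }(Z_{a1},\dots,Z_{an}),$$ satisfies, for all states $a,b$, $$\|f(a)-f(b)\|^2=T_{ab},$$ where $T_{ab}$ is the expected commuting time between $a$ and $b$.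
   Context: The chain has finite state set $\{1,\dots,n\}$ and transition probabilities $P_i{}^j=\mathrm{Prob}(\text{next at } j\mid\text{start at } i)$. Ergodic means that every state can be reached from every other state (irreducibility). The equilibrium distribution $w=(w^i)$ is the unique probability vector with $\sum_i w^iP_i{}^j=w^j$ for all $j$; all $w^i>0$. $P^{(\infty)}$ is the matrix all of whose rows equal $w$, i.e. its $(i,j)$ entry is $w^j$. The matrix $(Z_i{}^j)$ is defined by $$(Z_i{}^j)_{i,j}=(I-P+P^{(\infty)})^{-1}-P^{(\infty)}$$ (which equals $\sum_{k\ge 0}(P^k-P^{(\infty)})$ when that series converges), and $Z_{ij}=\frac{1}{w^j}Z_i{}^j$. Note that $Z_{ij}$ and $Z_i{}^j$ are different arrays. The matrix $\Delta^{ij}$ need not be symmetric. The commuting time $T_{ab}$ is the expected time, starting from $a$, to go to $b$ and then back to $a$; that is, $T_{ab}=M_{ab}+M_{ba}$, where $M_{ab}$ is the expected number of steps for the chain started at $a$ to first hit $b$ (with $M_{aa}=0$). *)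

theory Defs
  imports "HOL-Probability.Probability"
begin

section \<open>The chain\<close>

text \<open>
  The state set is a finite type \<open>'n\<close>; \<open>P $ i $ j\<close> is the probability that the next state
  is \<open>j\<close> when the current state is \<open>i\<close>.
\<close>

definition stochastic_matrix :: "real^'n^'n \<Rightarrow> bool" where
  "stochastic_matrix P \<longleftrightarrow> (\<forall>i j. 0 \<le> P $ i $ j) \<and> (\<forall>i. (\<Sum>j\<in>UNIV. P $ i $ j) = 1)"

text \<open>Ergodic means irreducible here; periodic chains are allowed.\<close>

definition ergodic :: "real^'n^'n \<Rightarrow> bool" where
  "ergodic P \<longleftrightarrow> (\<forall>i j. (i, j) \<in> {(k, l). 0 < P $ k $ l}\<^sup>*)"

definition equilibrium_distribution :: "real^'n^'n \<Rightarrow> real^'n \<Rightarrow> bool" where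
  "equilibrium_distribution P w \<longleftrightarrow>
     (\<forall>i. 0 \<le> w $ i) \<and> (\<Sum>i\<in>UNIV. w $ i) = 1 \<and> w v* P = w"

section \<open>Expected hitting and commuting times\<close>

text \<open>
  The law of the trajectory \<open>(X\<^sub>0, X\<^sub>1, \<dots>)\<close> of the chain started at \<open>a\<close> is the
  Ionescu-Tulcea measure on \<open>nat \<Rightarrow> 'n\<close> of the following kernels, which give the conditional
  law of \<open>X\<^sub>k\<close> given the history \<open>X\<^sub>0, \<dots>, X\<^bsub>k-1\<^esub>\<close>.
\<close>

definition step_kernel :: "real^'n^'n \<Rightarrow> 'n \<Rightarrow> nat \<Rightarrow> (nat \<Rightarrow> 'n) \<Rightarrow> 'n measure" where
  "step_kernel P a k \<omega> =
     (case k of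
        0 \<Rightarrow> return (count_space UNIV) a
      | Suc m \<Rightarrow> point_measure UNIV (\<lambda>j. ennreal (P $ \<omega> m $ j)))"

definition path_measure :: "real^'n^'n \<Rightarrow> 'n \<Rightarrow> (nat \<Rightarrow> 'n) measure" where
  "path_measure P a =
     projective_family.lim UNIV
       (Ionescu_Tulcea.CI (step_kernel P a) (\<lambda>_. count_space UNIV))
       (\<lambda>_. count_space UNIV)"

definition hitting_time :: "'n \<Rightarrow> (nat \<Rightarrow> 'n) \<Rightarrow> enat" where
  "hitting_time b \<omega> = (INF k\<in>{k. \<omega> k = b}. enat k)"

definition expected_hitting_time :: "real^'n^'n \<Rightarrow> 'n \<Rightarrow> 'n \<Rightarrow> ennreal" where
  "expected_hitting_time P a b =
     (\<integral>\<^sup>+ \<omega>. ennreal_of_enat (hitting_time b \<omega>) \<partial>path_measure P a)"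

definition commuting_time :: "real^'n^'n \<Rightarrow> 'n \<Rightarrow> 'n \<Rightarrow> ennreal" where
  "commuting_time P a b = expected_hitting_time P a b + expected_hitting_time P b a"

text \<open>
  The locale constants used for \<^const>\<open>path_measure\<close> are meaningful only where the locale
  predicate holds, which it does for stochastic matrices; the resulting process has the
  finite-dimensional distributions of the chain.
\<close>

lemma measurable_finite_PiM_count_space:
  fixes N :: "'b measure"
  assumes "\<And>\<omega>. g \<omega> \<in> space N"
  shows "(\<lambda>\<omega>. g (\<omega> m)) \<in> measurable (PiM {0..<Suc m} (\<lambda>_. count_space (UNIV :: 'n::finite set))) N"
  by (rule measurable_compose[OF measurable_component_singleton[of m "{0..<Suc m}"]])
     (auto simp: assms)

lemma prob_space_step:
  fixes P :: "real^'n^'n"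
  assumes "stochastic_matrix P"
  shows "prob_space (point_measure UNIV (\<lambda>j. ennreal (P $ i $ j)))"
  using assms
  by (intro prob_space_point_measure) (auto simp: stochastic_matrix_def sum_ennreal)

lemma Ionescu_Tulcea_step_kernel:
  fixes P :: "real^'n^'n"
  assumes "stochastic_matrix P"
  shows "Ionescu_Tulcea (step_kernel P a) (\<lambda>_. count_space UNIV)"
proof (rule Ionescu_Tulcea.intro)
  show "step_kernel P a i \<in>
      measurable (PiM {0..<i} (\<lambda>_. count_space UNIV)) (subprob_algebra (count_space UNIV))" for i
  proof (cases i)
    case 0
    then show ?thesis
      unfolding step_kernel_def
      by (auto intro!: measurable_const simp: space_subprob_algebra prob_space_return
            prob_space_imp_subprob_space)
  next
    case (Suc m)
    show ?thesis
      unfolding step_kernel_def Suc nat.case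
      by (rule measurable_finite_PiM_count_space)
         (auto simp: space_subprob_algebra sets_point_measure
            intro!: prob_space_imp_subprob_space prob_space_step[OF assms])
  qed
  show "prob_space (step_kernel P a i x)"
    if "x \<in> space (PiM {0..<i} (\<lambda>_. count_space UNIV))" for i x
    unfolding step_kernel_def
    by (cases i) (auto simp: prob_space_return prob_space_step[OF assms])
qed

lemma emeasure_path_measure_cylinder:
  fixes P :: "real^'n^'n"
  assumes P: "stochastic_matrix P"
  shows "emeasure (path_measure P a) {\<omega>. \<forall>i\<le>k. \<omega> i = x i} =
           (if x 0 = a then ennreal (\<Prod>i<k. P $ x i $ x (Suc i)) else 0)"
proof -
  interpret IT: Ionescu_Tulcea "step_kernel P a" "\<lambda>_. count_space UNIV"
    by (rule Ionescu_Tulcea_step_kernel[OF P])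
  let ?M = "\<lambda>n. PiM {0..<n} (\<lambda>_. count_space (UNIV :: 'n set))"
  define A where "A n = PiE {0..<n} (\<lambda>i. {x i})" for n
  have A[measurable]: "A n \<in> sets (?M n)" for n
    unfolding A_def by (intro sets_PiM_I_finite) auto
  have A_iff: "A n = {restrict x {0..<n}}" for n
    unfolding A_def by (rule set_eqI) (auto simp: PiE_iff extensional_def fun_eq_iff restrict_def)
  have rs: "restrict x {0..<n} \<in> space (?M n)" for n
    by (auto simp: space_PiM)
  have step: "emeasure (IT.C 0 (Suc n) (\<lambda>_. undefined)) (A (Suc n)) =
      emeasure (step_kernel P a n (restrict x {0..<n})) {x n} *
      emeasure (IT.C 0 n (\<lambda>_. undefined)) (A n)" for n
  proof -
    have s: "space (IT.C 0 n (\<lambda>_. undefined)) = space (?M n)"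
      using IT.space_C[of "\<lambda>_. undefined" 0 n] by (simp add: space_PiM)
    have st: "sets (IT.C 0 n (\<lambda>_. undefined)) = sets (?M n)"
      using IT.sets_C[of "\<lambda>_. undefined" 0 n] by (simp add: space_PiM)
    have "emeasure (IT.C 0 (Suc n) (\<lambda>_. undefined)) (A (Suc n)) =
        (\<integral>\<^sup>+\<omega>. emeasure (IT.eP n \<omega>) (A (Suc n)) \<partial>IT.C 0 n (\<lambda>_. undefined))"
      using IT.measurable_eP[of n]
      by (simp, intro emeasure_bind[where N="?M (Suc n)"])
         (auto simp: s space_PiM measurable_cong_sets[OF st refl])
    also have "\<dots> = (\<integral>\<^sup>+\<omega>. emeasure (step_kernel P a n (restrict x {0..<n})) {x n} *
        indicator (A n) \<omega> \<partial>IT.C 0 n (\<lambda>_. undefined))"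
    proof (rule nn_integral_cong)
      fix \<omega> assume "\<omega> \<in> space (IT.C 0 n (\<lambda>_. undefined))"
      then have \<omega>: "\<omega> \<in> space (?M n)" by (simp add: s)
      then have e: "\<omega> \<in> extensional {0..<n}" by (auto simp: space_PiM PiE_iff)
      have "fun_upd \<omega> n y \<in> A (Suc n) \<longleftrightarrow> y = x n \<and> \<omega> \<in> A n" for y
        using e by (auto simp: A_def PiE_iff extensional_def less_Suc_eq)
      then have "(\<lambda>y. fun_upd \<omega> n y) -` A (Suc n) \<inter> UNIV = (if \<omega> \<in> A n then {x n} else {})"
        by auto
      then show "emeasure (IT.eP n \<omega>) (A (Suc n)) =
          emeasure (step_kernel P a n (restrict x {0..<n})) {x n} * indicator (A n) \<omega>"
        using IT.emeasure_eP[OF \<omega> A] by (auto simp: A_iff)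
    qed
    also have "\<dots> = emeasure (step_kernel P a n (restrict x {0..<n})) {x n} *
      emeasure (IT.C 0 n (\<lambda>_. undefined)) (A n)"
      by (intro nn_integral_cmult_indicator) (simp add: st)
    finally show ?thesis .
  qed
  have C: "emeasure (IT.C 0 (Suc n) (\<lambda>_. undefined)) (A (Suc n)) =
      (if x 0 = a then ennreal (\<Prod>i<n. P $ x i $ x (Suc i)) else 0)" for n
  proof (induction n)
    case 0
    have "emeasure (IT.C 0 0 (\<lambda>_. undefined)) (A 0) = 1"
      by (simp add: A_def PiM_empty)
    moreover have "emeasure (step_kernel P a 0 (restrict x {0..<0})) {x 0} =
        (if x 0 = a then 1 else 0)"
      by (auto simp: step_kernel_def)
    ultimately show ?case
      using step[of 0] by (simp del: IT.C.simps)
  next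
    case (Suc n)
    have "emeasure (step_kernel P a (Suc n) (restrict x {0..<Suc n})) {x (Suc n)} =
        ennreal (P $ x n $ x (Suc n))"
      by (simp add: step_kernel_def emeasure_point_measure_finite)
    moreover have "0 \<le> P $ i $ j" for i j
      using P by (simp add: stochastic_matrix_def)
    ultimately show ?case
      using step[of "Suc n"] Suc
      by (simp add: ennreal_mult' prod_nonneg mult.commute del: IT.C.simps)
  qed
  have "{\<omega>. \<forall>i\<le>k. \<omega> i = x i} = IT.PF.emb UNIV {0..<Suc k} (A (Suc k))"
    by (auto simp: prod_emb_def A_def PiE_iff space_PiM less_Suc_eq_le)
  then have "emeasure (path_measure P a) {\<omega>. \<forall>i\<le>k. \<omega> i = x i} =
      emeasure (IT.CI {0..<Suc k}) (A (Suc k))"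
    unfolding path_measure_def using IT.lim[OF _ A, of "Suc k"] by simp
  also have "\<dots> = emeasure (IT.C 0 (Suc k) (\<lambda>_. undefined)) (A (Suc k))"
    using A[of "Suc k"] sets.sets_into_space[OF A, of "Suc k"]
    by (subst IT.emeasure_CI[of _ "Suc k"]) (auto simp: prod_emb_id space_PiM simp del: IT.C.simps)
  finally show ?thesis using C[of k] by simp
qed

section \<open>Laplacian and fundamental matrix\<close>

definition laplacian :: "real^'n^'n \<Rightarrow> real^'n \<Rightarrow> real^'n^'n" where
  "laplacian P w = (\<chi> i j. w $ i * ((if i = j then 1 else 0) - P $ i $ j))"

definition laplacian_form :: "real^'n^'n \<Rightarrow> real^'n \<Rightarrow> real^'n \<Rightarrow> real" where
  "laplacian_form P w x = (\<Sum>i\<in>UNIV. \<Sum>j\<in>UNIV. x $ i * laplacian P w $ i $ j * x $ j)"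

definition P_infinity :: "real^'n \<Rightarrow> real^'n^'n" where
  "P_infinity w = (\<chi> i j. w $ j)"

text \<open>\<open>Z_mixed\<close> is the array with one lower and one upper index, \<open>Z_lower\<close> the one with
  two lower indices.\<close>

definition Z_mixed :: "real^'n^'n \<Rightarrow> real^'n \<Rightarrow> real^'n^'n" where
  "Z_mixed P w = matrix_inv (mat 1 - P + P_infinity w) - P_infinity w"

definition Z_lower :: "real^'n^'n \<Rightarrow> real^'n \<Rightarrow> real^'n^'n" where
  "Z_lower P w = (\<chi> i j. 1 / w $ j * Z_mixed P w $ i $ j)"

section \<open>The quotient of \<open>\<real>\<^sup>n\<close> by the constant vectors\<close>

quotient_type 'n ones_quotient =
  "real^('n::finite)" / "\<lambda>x y. x - y \<in> span {vec 1}"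
proof (rule equivpI)
  show "reflp (\<lambda>x y :: real^'n. x - y \<in> span {vec 1})"
    by (auto intro!: reflpI simp: span_zero)
  show "symp (\<lambda>x y :: real^'n. x - y \<in> span {vec 1})"
    by (rule sympI) (metis minus_diff_eq span_neg)
  show "transp (\<lambda>x y :: real^'n. x - y \<in> span {vec 1})"
  proof (rule transpI)
    fix x y z :: "real^'n"
    assume "x - y \<in> span {vec 1}" "y - z \<in> span {vec 1}"
    from span_add[OF this] show "x - z \<in> span {vec 1}" by simp
  qed
qed

instantiation ones_quotient :: (finite) real_vector
begin

lift_definition zero_ones_quotient :: "'a ones_quotient" is 0 .

lift_definition plus_ones_quotient :: "'a ones_quotient \<Rightarrow> 'a ones_quotient \<Rightarrow> 'a ones_quotient"
  is "(+)"
proof -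
  fix x x' y y' :: "real^'a"
  assume "x - x' \<in> span {vec 1}" "y - y' \<in> span {vec 1}"
  from span_add[OF this] show "(x + y) - (x' + y') \<in> span {vec 1}"
    by (simp add: algebra_simps)
qed

lift_definition uminus_ones_quotient :: "'a ones_quotient \<Rightarrow> 'a ones_quotient" is uminus
proof -
  fix x x' :: "real^'a"
  assume "x - x' \<in> span {vec 1}"
  from span_neg[OF this] show "- x - - x' \<in> span {vec 1}"
    by simp
qed

lift_definition minus_ones_quotient :: "'a ones_quotient \<Rightarrow> 'a ones_quotient \<Rightarrow> 'a ones_quotient"
  is "(-)"
proof -
  fix x x' y y' :: "real^'a"
  assume "x - x' \<in> span {vec 1}" "y - y' \<in> span {vec 1}"
  from span_diff[OF this] show "(x - y) - (x' - y') \<in> span {vec 1}"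
    by (simp add: algebra_simps)
qed

lift_definition scaleR_ones_quotient :: "real \<Rightarrow> 'a ones_quotient \<Rightarrow> 'a ones_quotient" is scaleR
proof -
  fix c and x x' :: "real^'a"
  assume "x - x' \<in> span {vec 1}"
  from span_scale[OF this, of c] show "c *\<^sub>R x - c *\<^sub>R x' \<in> span {vec 1}"
    by (simp add: scaleR_right_diff_distrib)
qed

instance
  by standard (transfer; simp add: algebra_simps span_zero)+

end

lift_definition quotient_class :: "real^'n \<Rightarrow> 'n::finite ones_quotient" is "\<lambda>x. x" .

definition quadratic_form :: "('v::real_vector \<Rightarrow> real) \<Rightarrow> bool" where
  "quadratic_form q \<longleftrightarrow>
     (\<exists>B. bilinear B \<and> (\<forall>x y. B x y = B y x) \<and> (\<forall>x. q x = B x x))"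

definition positive_definite :: "('v::real_vector \<Rightarrow> real) \<Rightarrow> bool" where
  "positive_definite q \<longleftrightarrow> (\<forall>x. x \<noteq> 0 \<longrightarrow> 0 < q x)"

definition embedding :: "real^'n^'n \<Rightarrow> real^'n \<Rightarrow> 'n \<Rightarrow> 'n::finite ones_quotient" where
  "embedding P w a = quotient_class (\<chi> j. Z_lower P w $ a $ j)"

end

theory Submission
  imports Defs
begin

text \<open>
  For \<open>x = Z\<^sub>a - Z\<^sub>b\<close> the identity \<open>Z (I - P) = I - P\<^sup>\<infinity>\<close> gives
  \<open>\<Sum>\<^sub>i x\<^sub>i \<Delta>\<^sup>i\<^sup>j = \<delta>\<^sub>a\<^sub>j - \<delta>\<^sub>b\<^sub>j\<close>, so the form takes the value
  \<open>x\<^sub>a - x\<^sub>b = (Z\<^sub>b\<^sub>b - Z\<^sub>a\<^sub>b) + (Z\<^sub>a\<^sub>a - Z\<^sub>b\<^sub>a)\<close>. The other identity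
  \<open>(I - P) Z = I - P\<^sup>\<infinity>\<close> shows that \<open>g a = Z\<^sub>b\<^sub>b - Z\<^sub>a\<^sub>b\<close> solves the first-step equations
  \<open>g b = 0\<close> and \<open>g = 1 + P g\<close> off \<open>b\<close>. By the minimum principle \<open>g\<close> is nonnegative, hence it
  bounds the partial sums of the survival probabilities; their sum, the expected hitting time,
  solves the same equations and therefore equals \<open>g\<close>. Definiteness comes from writing the form
  as the energy \<open>\<onehalf> \<Sum>\<^sub>i\<^sub>j w\<^sup>i P\<^sub>i\<^sup>j (x\<^sub>i - x\<^sub>j)\<^sup>2\<close>, in which every \<open>w\<^sup>i\<close> is positive.
\<close>

section \<open>Survival probabilities\<close>

text \<open>The probability that the chain started at \<open>a\<close> avoids \<open>b\<close> at
  all times 0 to \<open>k\<close>, set up by first-step recursion. Time 0 counts, so the value at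
  \<open>a = b\<close> is 0, in accordance with a hitting time of 0 there.\<close>

primrec survival :: "real^'n^'n \<Rightarrow> 'n \<Rightarrow> nat \<Rightarrow> 'n \<Rightarrow> real" where
  "survival P b 0 a = (if a = b then 0 else 1)"
| "survival P b (Suc k) a = (if a = b then 0 else \<Sum>j\<in>UNIV. P $ a $ j * survival P b k j)"

lemma survival_nonneg: "stochastic_matrix P \<Longrightarrow> 0 \<le> survival P b k a"
  by (induction k arbitrary: a) (auto simp: stochastic_matrix_def intro!: sum_nonneg)

text \<open>First-step equation for the truncated means E min(T, K), T being the hitting time of
  \<open>b\<close>. It serves both to bound these sums by induction and, in the limit, to give the
  equation for the full sum.\<close>

lemma survival_partial_sum_Suc:
  fixes P :: "real^'n^'n"
  shows "(\<Sum>k<Suc K. survival P b k a) =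
     (if a = b then 0 else 1 + (\<Sum>j\<in>UNIV. P $ a $ j * (\<Sum>k<K. survival P b k j)))"
  unfolding sum.lessThan_Suc_shift
  by (simp add: sum_distrib_left sum.swap[of _ "{..<K}" UNIV])

section \<open>Avoidance probabilities under the path measure\<close>

lemma space_path_measure [simp]:
  "stochastic_matrix P \<Longrightarrow> space (path_measure P a) = UNIV"
proof -
  assume P: "stochastic_matrix P"
  interpret IT: Ionescu_Tulcea "step_kernel P a" "\<lambda>_. count_space UNIV"
    by (rule Ionescu_Tulcea_step_kernel[OF P])
  show ?thesis
    unfolding path_measure_def by (simp add: space_PiM)
qed

lemma sets_path_measure:
  "stochastic_matrix P \<Longrightarrow> sets (path_measure P a) = sets (PiM UNIV (\<lambda>_. count_space UNIV))"
proof -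
  assume P: "stochastic_matrix P"
  interpret IT: Ionescu_Tulcea "step_kernel P a" "\<lambda>_. count_space UNIV"
    by (rule Ionescu_Tulcea_step_kernel[OF P])
  show ?thesis
    unfolding path_measure_def by simp
qed

lemma measurable_visit:
  fixes P :: "real^'n^'n"
  assumes "stochastic_matrix P"
  shows "Measurable.pred (path_measure P a) (\<lambda>\<omega>. \<omega> i = j)"
proof -
  have "Measurable.pred (PiM UNIV (\<lambda>_. count_space (UNIV :: 'n set))) (\<lambda>\<omega>. \<omega> (i :: nat) = j)"
    by measurable
  then show ?thesis
    by (simp add: measurable_cong_sets[OF sets_path_measure[OF assms] refl])
qed

text \<open>Conditioning on longer and longer prefixes replaces the Markov property, so that
  the cylinder probabilities are all that is needed.\<close>

lemma emeasure_path_measure_prefix_avoiding: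
  fixes P :: "real^'n^'n"
  assumes P: "stochastic_matrix P"
  shows "(\<And>i. i < m \<Longrightarrow> y i \<noteq> b) \<Longrightarrow>
    emeasure (path_measure P a) {\<omega>. (\<forall>i\<le>m. \<omega> i = y i) \<and> (\<forall>i\<le>m + k. \<omega> i \<noteq> b)} =
      (if y 0 = a then ennreal ((\<Prod>i<m. P $ y i $ y (Suc i)) * survival P b k (y m)) else 0)"
proof (induction k arbitrary: m y)
  case 0
  show ?case
  proof (cases "y m = b")
    case True
    then have "{\<omega>. (\<forall>i\<le>m. \<omega> i = y i) \<and> (\<forall>i\<le>m + 0. \<omega> i \<noteq> b)} = {}"
      by auto
    then show ?thesis using True by (simp only:) simp
  next
    case False
    then have "y i \<noteq> b" if "i \<le> m" for i
      using 0 that by (cases "i = m") auto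
    then have "{\<omega>. (\<forall>i\<le>m. \<omega> i = y i) \<and> (\<forall>i\<le>m + 0. \<omega> i \<noteq> b)} = {\<omega>. \<forall>i\<le>m. \<omega> i = y i}"
      by (intro Collect_cong) (metis add_0_right)
    then show ?thesis
      using emeasure_path_measure_cylinder[OF P, of a m y] False by (simp only:) simp
  qed
next
  case (Suc k)
  note [measurable] = measurable_visit[OF P]
  define B where
    "B m y k = {\<omega>. (\<forall>i\<le>m. \<omega> i = y i) \<and> (\<forall>i\<le>m + k. \<omega> i \<noteq> b)}" for m k and y :: "nat \<Rightarrow> 'n"
  have nonneg: "0 \<le> (\<Prod>i<m. P $ y i $ y (Suc i))"
    using P by (auto simp: stochastic_matrix_def intro!: prod_nonneg)
  have B_sets: "B m y k \<in> sets (path_measure P a)" for m k y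
  proof -
    have "B m y k = {\<omega> \<in> space (path_measure P a). (\<forall>i\<le>m. \<omega> i = y i) \<and> (\<forall>i\<le>m + k. \<omega> i \<noteq> b)}"
      by (simp add: B_def P)
    also have "\<dots> \<in> sets (path_measure P a)"
      by measurable
    finally show ?thesis .
  qed
  show ?case
  proof (cases "y m = b")
    \<comment> \<open>The hypothesis on \<open>y\<close> stops short of time \<open>m\<close>, so
      the prefix may end in \<open>b\<close>; then the event is empty and \<open>survival\<close>
      vanishes at \<open>b\<close>.\<close>
    case True
    then have "{\<omega>. (\<forall>i\<le>m. \<omega> i = y i) \<and> (\<forall>i\<le>m + Suc k. \<omega> i \<noteq> b)} = {}"
      by force
    then show ?thesis using True by (simp only:) simp
  next
    case False
    then have y: "y i \<noteq> b" if "i < Suc m" for i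
      using Suc.prems that by (cases "i = m") auto
    \<comment> \<open>Splitting by the state \<open>j\<close> at time \<open>Suc m\<close> lengthens
      the prefix by one step and shortens the remaining window by one. The horizon is unchanged, so
      the induction hypothesis applies to each piece.\<close>
    define z where "z j = y(Suc m := j)" for j
    have z: "i < Suc m \<Longrightarrow> z j i = y i" "z j (Suc m) = j" for i j
      by (auto simp: z_def)
    have "B m y (Suc k) = (\<Union>j\<in>UNIV. B (Suc m) (z j) k)"
      by (auto simp: B_def z_def le_Suc_eq)
    then have "emeasure (path_measure P a) (B m y (Suc k)) =
        (\<Sum>j\<in>UNIV. emeasure (path_measure P a) (B (Suc m) (z j) k))"
    proof (simp only:, intro sum_emeasure[symmetric])
      show "range (\<lambda>j. B (Suc m) (z j) k) \<subseteq> sets (path_measure P a)"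
        using B_sets by blast
      show "disjoint_family (\<lambda>j. B (Suc m) (z j) k)"
        by (auto simp: disjoint_family_on_def B_def z_def)
    qed simp
    also have "\<dots> = (\<Sum>j\<in>UNIV. if y 0 = a
        then ennreal ((\<Prod>i<m. P $ y i $ y (Suc i)) * (P $ y m $ j * survival P b k j)) else 0)"
    proof (rule sum.cong[OF refl])
      fix j
      have "z j i \<noteq> b" if "i < Suc m" for i
        using y that by (simp add: z)
      from Suc.IH[OF this, folded B_def]
      show "emeasure (path_measure P a) (B (Suc m) (z j) k) = (if y 0 = a
        then ennreal ((\<Prod>i<m. P $ y i $ y (Suc i)) * (P $ y m $ j * survival P b k j)) else 0)"
        by (simp add: z mult.assoc)
    qed
    also have "\<dots> = (if y 0 = a
        then ennreal ((\<Prod>i<m. P $ y i $ y (Suc i)) * survival P b (Suc k) (y m)) else 0)"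
      using P False nonneg survival_nonneg[OF P]
      by (simp add: sum_ennreal stochastic_matrix_def sum_distrib_left)
    finally show ?thesis by (simp add: B_def)
  qed
qed

lemma emeasure_path_measure_avoiding:
  fixes P :: "real^'n^'n"
  assumes P: "stochastic_matrix P"
  shows "emeasure (path_measure P a) {\<omega>. \<forall>i\<le>k. \<omega> i \<noteq> b} = ennreal (survival P b k a)"
proof -
  note [measurable] = measurable_visit[OF P]
  \<comment> \<open>Prefixes of length one: the event is split by the initial state
    \<open>c\<close>, and only \<open>c = a\<close> has positive mass.\<close>
  define B where "B c = {\<omega>. (\<forall>i\<le>0. \<omega> i = c) \<and> (\<forall>i\<le>0 + k. \<omega> i \<noteq> b)}" for c
  have B_sets: "B c \<in> sets (path_measure P a)" for c
  proof -
    have "B c = {\<omega> \<in> space (path_measure P a). (\<forall>i\<le>0. \<omega> i = c) \<and> (\<forall>i\<le>0 + k. \<omega> i \<noteq> b)}"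
      by (simp add: B_def P)
    also have "\<dots> \<in> sets (path_measure P a)"
      by measurable
    finally show ?thesis .
  qed
  have "emeasure (path_measure P a) {\<omega>. \<forall>i\<le>k. \<omega> i \<noteq> b} =
      emeasure (path_measure P a) (\<Union>c\<in>UNIV. B c)"
    by (rule arg_cong[where f = "emeasure _"]) (auto simp: B_def)
  also have "\<dots> = (\<Sum>c\<in>UNIV. emeasure (path_measure P a) (B c))"
  proof (rule sum_emeasure[symmetric])
    show "range B \<subseteq> sets (path_measure P a)"
      using B_sets by blast
    show "disjoint_family B"
      by (auto simp: disjoint_family_on_def B_def)
  qed simp
  also have "\<dots> = (\<Sum>c\<in>UNIV. if c = a then ennreal (survival P b k c) else 0)"
    using emeasure_path_measure_prefix_avoiding[OF P, of 0 "\<lambda>_. c" b a k for c, folded B_def]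
    by simp
  finally show ?thesis by simp
qed

section \<open>Expected hitting time as a tail sum\<close>

lemma hitting_time_eq_Least:
  "hitting_time b \<omega> = (if \<exists>k. \<omega> k = b then enat (LEAST k. \<omega> k = b) else \<infinity>)"
proof (cases "\<exists>k. \<omega> k = b")
  case True
  then have "\<omega> (LEAST k. \<omega> k = b) = b"
    by (rule LeastI_ex)
  then show ?thesis
    using True unfolding hitting_time_def
    by (auto intro!: antisym INF_lower INF_greatest Least_le)
next
  case False
  then show ?thesis
    by (simp add: hitting_time_def top_enat_def)
qed

lemma less_hitting_time_iff: "enat k < hitting_time b \<omega> \<longleftrightarrow> (\<forall>i\<le>k. \<omega> i \<noteq> b)"
proof -
  have "k < (LEAST k. \<omega> k = b) \<longleftrightarrow> (\<forall>i\<le>k. \<omega> i \<noteq> b)" if "\<omega> l = b" for l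
    using that by (metis (mono_tags, lifting) LeastI Least_le leD leI order.trans)
  then show ?thesis
    by (auto simp: hitting_time_eq_Least)
qed

text \<open>Tail-sum formula E T = \<Sum>k. Prob(T > k), valid in \<open>ennreal\<close> before
  finiteness is known.\<close>

lemma expected_hitting_time_eq_suminf:
  assumes P: "stochastic_matrix P"
  shows "expected_hitting_time P a b = (\<Sum>k. ennreal (survival P b k a))"
proof -
  note [measurable] = measurable_visit[OF P]
  have "hitting_time b \<in> measurable (path_measure P a) (count_space UNIV)"
    unfolding hitting_time_eq_Least[abs_def] by measurable
  then show ?thesis
    unfolding expected_hitting_time_def
    by (simp add: nn_integral_enat_function P less_hitting_time_iff
        emeasure_path_measure_avoiding)
qed

section \<open>Matrices\<close>

lemma matrix_diff_ldistrib: "A ** (B - C) = A ** B - A ** C"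
  for A :: "'a::ring_1^'n^'m" and B C :: "'a^'k^'n"
  by (simp add: vec_eq_iff matrix_matrix_mult_def right_diff_distrib sum_subtractf)

lemma matrix_diff_rdistrib: "(A - B) ** C = A ** C - B ** C"
  for A B :: "'a::ring_1^'n^'m" and C :: "'a^'k^'n"
  by (simp add: vec_eq_iff matrix_matrix_mult_def left_diff_distrib sum_subtractf)

lemma matrix_plus_rdistrib: "(A + B) ** C = A ** C + B ** C"
  for A B :: "'a::ring_1^'n^'m" and C :: "'a^'k^'n"
  by (simp add: vec_eq_iff matrix_matrix_mult_def distrib_right sum.distrib)

lemma invertible_matrix_inv:
  assumes "invertible A"
  shows "A ** matrix_inv A = mat 1" and "matrix_inv A ** A = mat 1"
  using someI_ex[OF assms[unfolded invertible_def]] by (auto simp: matrix_inv_def)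

section \<open>Irreducible chains\<close>

locale irreducible_chain =
  fixes P :: "real^'n^'n" and w :: "real^'n"
  assumes stochastic: "stochastic_matrix P"
    and irreducible: "ergodic P"
    and equilibrium: "equilibrium_distribution P w"
begin

section \<open>Minimum principle and positivity of the equilibrium\<close>

lemma P_nonneg: "0 \<le> P $ i $ j"
  using stochastic by (simp add: stochastic_matrix_def)

lemma row_sum: "(\<Sum>j\<in>UNIV. P $ i $ j) = 1"
  using stochastic by (simp add: stochastic_matrix_def)

text \<open>Were the minimum below \<open>h b\<close>, it would be attained at some
  \<open>c\<close>. The averaging inequality passes the minimal value along every edge leaving a
  state other than \<open>b\<close>, so a path from \<open>c\<close> to \<open>b\<close> would carry
  it to \<open>b\<close>.\<close>

lemma minimum_principle:
  fixes h :: "'n \<Rightarrow> real"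
  assumes super: "\<And>a. a \<noteq> b \<Longrightarrow> (\<Sum>j\<in>UNIV. P $ a $ j * h j) \<le> h a"
  shows "h b \<le> h a"
proof (rule ccontr)
  assume "\<not> h b \<le> h a"
  define m where "m = Min (range h)"
  have m_le: "m \<le> h j" for j
    by (simp add: m_def)
  obtain c where c: "h c = m"
    unfolding m_def by (metis Min_in finite finite_imageI imageE UNIV_not_empty image_is_empty)
  have "m < h b"
    using m_le[of a] \<open>\<not> h b \<le> h a\<close> by linarith
  have "(c, b) \<in> {(k, l). 0 < P $ k $ l}\<^sup>*"
    using irreducible by (simp add: ergodic_def)
  then have "h b = m"
  proof (induction rule: rtrancl_induct)
    case base
    show ?case by (rule c)
  next
    case (step k l)
    then have "k \<noteq> b"
      using \<open>m < h b\<close> by auto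
    \<comment> \<open>The excess over the minimum is nonnegative with mean at most 0, hence it
      vanishes at every successor of \<open>k\<close>.\<close>
    have "(\<Sum>j\<in>UNIV. P $ k $ j * (h j - m)) = (\<Sum>j\<in>UNIV. P $ k $ j * h j) - m"
      by (simp add: algebra_simps sum_subtractf row_sum flip: sum_distrib_left)
    also have "\<dots> \<le> 0"
      using super[OF \<open>k \<noteq> b\<close>] step.IH by simp
    finally have "(\<Sum>j\<in>UNIV. P $ k $ j * (h j - m)) = 0"
      by (intro antisym sum_nonneg) (auto simp: P_nonneg m_le)
    then have "P $ k $ l * (h l - m) = 0"
      by (subst (asm) sum_nonneg_eq_0_iff) (auto simp: P_nonneg m_le)
    then show ?case
      using step.hyps by simp
  qed
  then show False
    using \<open>m < h b\<close> by simp
qed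

lemma equilibrium_nonneg: "0 \<le> w $ i"
  and equilibrium_sum: "(\<Sum>i\<in>UNIV. w $ i) = 1"
  using equilibrium by (auto simp: equilibrium_distribution_def)

lemma equilibrium_stationary: "(\<Sum>i\<in>UNIV. w $ i * P $ i $ j) = w $ j"
proof -
  have "(w v* P) $ j = w $ j"
    using equilibrium by (simp add: equilibrium_distribution_def)
  then show ?thesis
    by (simp add: vector_matrix_mult_def mult.commute)
qed

text \<open>Some state has positive mass, and stationarity spreads positivity along edges;
  irreducibility carries it to every state.\<close>

lemma equilibrium_pos: "0 < w $ j"
proof -
  have "\<exists>i. w $ i \<noteq> 0"
    using equilibrium_sum by (metis sum.neutral zero_neq_one)
  then obtain i where "0 < w $ i"
    using equilibrium_nonneg by (metis order_le_less)
  have "(i, j) \<in> {(k, l). 0 < P $ k $ l}\<^sup>*"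
    using irreducible by (simp add: ergodic_def)
  then show ?thesis
  proof (induction rule: rtrancl_induct)
    case base
    show ?case by (rule \<open>0 < w $ i\<close>)
  next
    case (step k l)
    then have "0 < w $ k * P $ k $ l"
      by simp
    also have "\<dots> \<le> (\<Sum>i\<in>UNIV. w $ i * P $ i $ l)"
      by (rule member_le_sum) (auto simp: equilibrium_nonneg P_nonneg)
    finally show ?case
      by (simp add: equilibrium_stationary)
  qed
qed

subsection \<open>The fundamental matrix\<close>

lemma P_infinity_mult_P: "P_infinity w ** P = P_infinity w"
  by (simp add: vec_eq_iff matrix_matrix_mult_def P_infinity_def equilibrium_stationary)

lemma P_mult_P_infinity: "P ** P_infinity w = P_infinity w"
  by (simp add: vec_eq_iff matrix_matrix_mult_def P_infinity_def row_sum flip: sum_distrib_right)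

lemma P_infinity_idem: "P_infinity w ** P_infinity w = P_infinity w"
  by (simp add: vec_eq_iff matrix_matrix_mult_def P_infinity_def equilibrium_sum
      flip: sum_distrib_right)

lemma invertible_fundamental: "invertible (mat 1 - P + P_infinity w)"
proof -
  have "x = 0" if ker: "(mat 1 - P + P_infinity w) *v x = 0" for x
  proof -
    \<comment> \<open>Multiplying by \<open>P_infinity w\<close> on the left annihilates
      \<open>mat 1 - P\<close>. So a kernel vector has mean 0 under \<open>w\<close>, and is
      therefore harmonic.\<close>
    have "P_infinity w *v x = (P_infinity w ** (mat 1 - P + P_infinity w)) *v x"
      by (simp add: matrix_add_ldistrib matrix_diff_ldistrib P_infinity_mult_P P_infinity_idem)
    also have "\<dots> = 0"
      by (simp add: ker flip: matrix_vector_mul_assoc)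
    finally have proj: "P_infinity w *v x = 0" .
    then have "P *v x = x"
      using ker by (simp add: matrix_vector_mult_add_rdistrib matrix_vector_mult_diff_rdistrib)
    then have harm: "(\<Sum>j\<in>UNIV. P $ a $ j * x $ j) = x $ a" for a
      by (simp add: vec_eq_iff matrix_vector_mult_def)
    \<comment> \<open>A harmonic vector meets the hypothesis of the minimum principle for every
      choice of \<open>b\<close>, so it is constant; the constant is its \<open>w\<close>-mean,
      which is 0.\<close>
    have le: "x $ b \<le> x $ a" for a b
      using minimum_principle[of b "\<lambda>j. x $ j"] by (simp add: harm)
    have const: "x $ j = x $ a" for j a
      by (intro antisym le)
    have "x $ a = (\<Sum>j\<in>UNIV. w $ j * x $ a)" for a
      by (simp add: equilibrium_sum flip: sum_distrib_right)
    also have "\<dots> a = (P_infinity w *v x) $ a" for a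
      by (auto simp: P_infinity_def matrix_vector_mult_def intro!: sum.cong const)
    finally show ?thesis
      by (simp add: proj vec_eq_iff)
  qed
  then show ?thesis
    by (simp add: invertible_left_inverse matrix_left_invertible_ker)
qed

text \<open>\<open>A\<close> fixes \<open>P_infinity w\<close> on both sides, hence so does its
  inverse, and the products expand. The left identity drives the hitting times, the right one the
  contraction with the Laplacian.\<close>

lemma fundamental_identities:
  shows Z_mixed_left: "(mat 1 - P) ** Z_mixed P w = mat 1 - P_infinity w"
    and Z_mixed_right: "Z_mixed P w ** (mat 1 - P) = mat 1 - P_infinity w"
proof -
  define A where "A = mat 1 - P + P_infinity w"
  define N where "N = matrix_inv A"
  have inv: "A ** N = mat 1" "N ** A = mat 1"
    using invertible_fundamental by (auto simp: N_def A_def invertible_matrix_inv)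
  have A1: "A ** P_infinity w = P_infinity w" and A2: "P_infinity w ** A = P_infinity w"
    by (auto simp: A_def matrix_add_ldistrib matrix_diff_ldistrib matrix_plus_rdistrib
        matrix_diff_rdistrib P_infinity_mult_P P_mult_P_infinity P_infinity_idem)
  have N1: "N ** P_infinity w = P_infinity w"
    by (metis A1 inv(2) matrix_mul_assoc matrix_mul_lid)
  have N2: "P_infinity w ** N = P_infinity w"
    by (metis A2 inv(1) matrix_mul_assoc matrix_mul_rid)
  have 1: "mat 1 - P = A - P_infinity w"
    by (simp add: A_def)
  have 2: "Z_mixed P w = N - P_infinity w"
    by (simp add: Z_mixed_def N_def A_def)
  show "(mat 1 - P) ** Z_mixed P w = mat 1 - P_infinity w"
    "Z_mixed P w ** (mat 1 - P) = mat 1 - P_infinity w"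
    unfolding 1 2
    by (simp_all add: matrix_diff_ldistrib matrix_diff_rdistrib inv A1 A2 N1 N2 P_infinity_idem)
qed

lemma sum_P_Z_mixed:
  "(\<Sum>j\<in>UNIV. P $ a $ j * Z_mixed P w $ j $ b) =
     Z_mixed P w $ a $ b - (if a = b then 1 else 0) + w $ b"
proof -
  have "Z_mixed P w $ a $ b - (P ** Z_mixed P w) $ a $ b = (mat 1 - P_infinity w) $ a $ b"
    unfolding Z_mixed_left[symmetric] by (simp add: matrix_diff_rdistrib)
  then show ?thesis
    by (simp add: matrix_matrix_mult_def P_infinity_def mat_def split: if_splits)
qed

lemma sum_Z_mixed_P:
  "(\<Sum>i\<in>UNIV. Z_mixed P w $ a $ i * P $ i $ j) =
     Z_mixed P w $ a $ j - (if a = j then 1 else 0) + w $ j"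
proof -
  have "Z_mixed P w $ a $ j - (Z_mixed P w ** P) $ a $ j = (mat 1 - P_infinity w) $ a $ j"
    unfolding Z_mixed_right[symmetric] by (simp add: matrix_diff_ldistrib)
  then show ?thesis
    by (simp add: matrix_matrix_mult_def P_infinity_def mat_def split: if_splits)
qed

subsection \<open>Hitting times\<close>

text \<open>The term \<open>w $ b\<close> left over in \<open>sum_P_Z_mixed\<close>, divided by
  \<open>w $ b\<close>, becomes the 1 that counts one time step.\<close>

lemma hitting_potential_first_step:
  assumes "a \<noteq> b"
  shows "(\<Sum>j\<in>UNIV. P $ a $ j * (Z_lower P w $ b $ b - Z_lower P w $ j $ b)) =
    Z_lower P w $ b $ b - Z_lower P w $ a $ b - 1"
proof -
  have "(\<Sum>j\<in>UNIV. P $ a $ j * (Z_lower P w $ b $ b - Z_lower P w $ j $ b)) =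
      Z_lower P w $ b $ b - (\<Sum>j\<in>UNIV. P $ a $ j * Z_lower P w $ j $ b)"
    by (simp add: right_diff_distrib sum_subtractf row_sum flip: sum_distrib_right)
  also have "(\<Sum>j\<in>UNIV. P $ a $ j * Z_lower P w $ j $ b) =
      (\<Sum>j\<in>UNIV. P $ a $ j * Z_mixed P w $ j $ b) / w $ b"
    by (simp add: Z_lower_def sum_divide_distrib)
  finally show ?thesis
    using assms equilibrium_pos[of b]
    by (simp add: sum_P_Z_mixed Z_lower_def add_divide_distrib)
qed

lemma survival_sums:
  "(\<lambda>k. survival P b k a) sums (Z_lower P w $ b $ b - Z_lower P w $ a $ b)"
proof -
  define g where "g a = Z_lower P w $ b $ b - Z_lower P w $ a $ b" for a
  define s where "s a = (\<Sum>k. survival P b k a)" for a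
  have g_step: "(\<Sum>j\<in>UNIV. P $ a $ j * g j) = g a - 1" if "a \<noteq> b" for a
    using hitting_potential_first_step[OF that] by (simp add: g_def)
  have g_b: "g b = 0"
    by (simp add: g_def)
  have g_nonneg: "0 \<le> g a" for a
    using minimum_principle[of b g a] g_step g_b by fastforce
  \<comment> \<open>This bound is what makes the expected hitting time finite.\<close>
  have partial_le: "(\<Sum>k<K. survival P b k a) \<le> g a" for K a
  proof (induction K arbitrary: a)
    case 0
    show ?case by (simp add: g_nonneg)
  next
    case (Suc K)
    have "(\<Sum>j\<in>UNIV. P $ a $ j * (\<Sum>k<K. survival P b k j)) \<le> (\<Sum>j\<in>UNIV. P $ a $ j * g j)"
      by (intro sum_mono mult_left_mono Suc.IH P_nonneg)
    then show ?case
      unfolding survival_partial_sum_Suc using g_step[of a] g_nonneg[of a] by auto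
  qed
  have sums: "(\<lambda>k. survival P b k a) sums s a" for a
    unfolding s_def using partial_le survival_nonneg[OF stochastic]
    by (intro summable_sums summableI_nonneg_bounded)
  have s_b: "s b = 0"
  proof -
    have "survival P b k b = 0" for k
      by (cases k) auto
    then show ?thesis by (simp add: s_def)
  qed
  have s_step: "(\<Sum>j\<in>UNIV. P $ a $ j * s j) = s a - 1" if "a \<noteq> b" for a
  proof -
    have "(\<lambda>K. 1 + (\<Sum>j\<in>UNIV. P $ a $ j * (\<Sum>k<K. survival P b k j)))
        \<longlonglongrightarrow> 1 + (\<Sum>j\<in>UNIV. P $ a $ j * s j)"
      using sums by (intro tendsto_intros) (auto simp: sums_def)
    moreover have "(\<lambda>K. \<Sum>k<Suc K. survival P b k a) \<longlonglongrightarrow> s a"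
      using sums[of a] unfolding sums_def by (rule LIMSEQ_Suc)
    ultimately have "1 + (\<Sum>j\<in>UNIV. P $ a $ j * s j) = s a"
      using that unfolding survival_partial_sum_Suc by (simp add: LIMSEQ_unique)
    then show ?thesis by simp
  qed
  \<comment> \<open>Both functions solve the same first-step equations, so their difference is
    harmonic off \<open>b\<close> and vanishes at \<open>b\<close>. The minimum principle for both
    signs makes it 0.\<close>
  have "g b - s b \<le> g a - s a"
    by (rule minimum_principle)
       (simp add: right_diff_distrib sum_subtractf g_step s_step)
  moreover have "s b - g b \<le> s a - g a"
    by (rule minimum_principle[where h = "\<lambda>a. s a - g a"])
       (simp add: right_diff_distrib sum_subtractf g_step s_step)
  ultimately have "s a = g a"
    using s_b g_b by simp
  then show ?thesis
    using sums[of a] by (simp add: g_def)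
qed

lemma hitting_potential_nonneg: "0 \<le> Z_lower P w $ b $ b - Z_lower P w $ a $ b"
  using sums_le[OF _ sums_zero survival_sums] survival_nonneg[OF stochastic] by blast

lemma expected_hitting_time_eq:
  "expected_hitting_time P a b = ennreal (Z_lower P w $ b $ b - Z_lower P w $ a $ b)"
  unfolding expected_hitting_time_eq_suminf[OF stochastic]
  using survival_sums survival_nonneg[OF stochastic]
  by (intro suminf_ennreal_eq)

subsection \<open>The Dirichlet form\<close>

text \<open>Expand the square: the two diagonal sums agree, one by the row sums of \<open>P\<close>,
  the other by stationarity of \<open>w\<close>. Reversibility is not assumed, as the form sees only
  the symmetric part of the Laplacian.\<close>

lemma laplacian_form_eq_energy:
  "laplacian_form P w x =
     (\<Sum>i\<in>UNIV. \<Sum>j\<in>UNIV. w $ i * P $ i $ j * (x $ i - x $ j)\<^sup>2) / 2"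
proof -
  have diag: "(\<Sum>i\<in>UNIV. \<Sum>j\<in>UNIV. w $ i * P $ i $ j * (x $ i)\<^sup>2) = (\<Sum>i\<in>UNIV. w $ i * (x $ i)\<^sup>2)"
    by (simp add: row_sum flip: sum_distrib_left sum_distrib_right)
  have "(\<Sum>i\<in>UNIV. \<Sum>j\<in>UNIV. w $ i * P $ i $ j * (x $ j)\<^sup>2) =
      (\<Sum>j\<in>UNIV. (\<Sum>i\<in>UNIV. w $ i * P $ i $ j) * (x $ j)\<^sup>2)"
    by (subst sum.swap) (simp add: sum_distrib_right)
  then have diag': "(\<Sum>i\<in>UNIV. \<Sum>j\<in>UNIV. w $ i * P $ i $ j * (x $ j)\<^sup>2) =
      (\<Sum>j\<in>UNIV. w $ j * (x $ j)\<^sup>2)"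
    by (simp add: equilibrium_stationary)
  have "laplacian_form P w x = (\<Sum>i\<in>UNIV. \<Sum>j\<in>UNIV.
      (if i = j then w $ i * (x $ i)\<^sup>2 else 0) - w $ i * P $ i $ j * (x $ i * x $ j))"
    unfolding laplacian_form_def laplacian_def
    by (intro sum.cong refl) (simp add: algebra_simps power2_eq_square)
  also have "\<dots> = (\<Sum>i\<in>UNIV. w $ i * (x $ i)\<^sup>2) -
      (\<Sum>i\<in>UNIV. \<Sum>j\<in>UNIV. w $ i * P $ i $ j * (x $ i * x $ j))"
    by (simp add: sum_subtractf)
  also have "\<dots> = ((\<Sum>i\<in>UNIV. \<Sum>j\<in>UNIV. w $ i * P $ i $ j * (x $ i)\<^sup>2) +
      (\<Sum>i\<in>UNIV. \<Sum>j\<in>UNIV. w $ i * P $ i $ j * (x $ j)\<^sup>2) -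
      2 * (\<Sum>i\<in>UNIV. \<Sum>j\<in>UNIV. w $ i * P $ i $ j * (x $ i * x $ j))) / 2"
    by (simp add: diag diag')
  also have "\<dots> = (\<Sum>i\<in>UNIV. \<Sum>j\<in>UNIV. w $ i * P $ i $ j * (x $ i - x $ j)\<^sup>2) / 2"
    by (simp add: sum_distrib_left power2_diff algebra_simps
        flip: sum.distrib sum_subtractf)
  finally show ?thesis .
qed

lemma laplacian_form_nonneg: "0 \<le> laplacian_form P w x"
  unfolding laplacian_form_eq_energy
  by (auto intro!: sum_nonneg simp: P_nonneg equilibrium_nonneg)

lemma laplacian_form_eq_0_imp_const:
  assumes "laplacian_form P w x = 0"
  shows "x \<in> span {vec 1}"
proof -
  have "(\<Sum>j\<in>UNIV. w $ i * P $ i $ j * (x $ i - x $ j)\<^sup>2) = 0" for i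
    using assms unfolding laplacian_form_eq_energy
    by (simp, subst (asm) sum_nonneg_eq_0_iff)
       (auto intro!: sum_nonneg simp: P_nonneg equilibrium_nonneg)
  then have "w $ i * P $ i $ j * (x $ i - x $ j)\<^sup>2 = 0" for i j
    by (subst (asm) sum_nonneg_eq_0_iff) (auto simp: P_nonneg equilibrium_nonneg)
  then have edge: "x $ i = x $ j" if "0 < P $ i $ j" for i j
    using that equilibrium_pos[of i] by (metis eq_iff_diff_eq_0 less_irrefl mult_eq_0_iff
        zero_eq_power2)
  have "x $ i = x $ j" for i j
  proof -
    have "(i, j) \<in> {(k, l). 0 < P $ k $ l}\<^sup>*"
      using irreducible by (simp add: ergodic_def)
    then show ?thesis
      by (induction rule: rtrancl_induct) (auto dest: edge)
  qed
  \<comment> \<open>Here \<open>undefined\<close> is merely some state; all entries are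
    equal.\<close>
  then have "x = (x $ undefined) *\<^sub>R vec 1"
    by (simp add: vec_eq_iff)
  then show ?thesis
    by (metis span_base span_scale singletonI)
qed

lemma laplacian_form_potential:
  "laplacian_form P w (\<chi> j. Z_lower P w $ a $ j - Z_lower P w $ b $ j) =
     (Z_lower P w $ b $ b - Z_lower P w $ a $ b) + (Z_lower P w $ a $ a - Z_lower P w $ b $ a)"
proof -
  define x where "x = (\<chi> j. Z_lower P w $ a $ j - Z_lower P w $ b $ j)"
  define z where "z i = Z_mixed P w $ a $ i - Z_mixed P w $ b $ i" for i
  \<comment> \<open>The weight \<open>w $ i\<close> in the Laplacian cancels the denominator in
    \<open>Z_lower\<close>, leaving the mixed array.\<close>
  have xw: "x $ i * w $ i = z i" for i
    using equilibrium_pos[of i] by (simp add: x_def z_def Z_lower_def field_simps)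
  have "(\<Sum>i\<in>UNIV. x $ i * laplacian P w $ i $ j) =
      (if a = j then 1 else 0) - (if b = j then 1 else 0)" for j
  proof -
    have "(\<Sum>i\<in>UNIV. x $ i * laplacian P w $ i $ j) =
        (\<Sum>i\<in>UNIV. (if i = j then z i else 0) - z i * P $ i $ j)"
      by (intro sum.cong refl) (simp add: laplacian_def algebra_simps flip: xw)
    also have "\<dots> = z j - (\<Sum>i\<in>UNIV. z i * P $ i $ j)"
      by (simp add: sum_subtractf)
    also have "\<dots> = (if a = j then 1 else 0) - (if b = j then 1 else 0)"
      unfolding z_def left_diff_distrib sum_subtractf sum_Z_mixed_P by simp
    finally show ?thesis .
  qed
  then have "laplacian_form P w x =
      (\<Sum>j\<in>UNIV. ((if a = j then 1 else 0) - (if b = j then 1 else 0)) * x $ j)"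
    unfolding laplacian_form_def
    by (subst sum.swap) (simp flip: sum_distrib_right)
  also have "\<dots> = (\<Sum>j\<in>UNIV. (if a = j then x $ j else 0) - (if b = j then x $ j else 0))"
    by (intro sum.cong refl) (simp add: left_diff_distrib)
  also have "\<dots> = x $ a - x $ b"
    by (simp add: sum_subtractf)
  finally show ?thesis
    by (simp add: x_def)
qed

end

section \<open>The energy on the quotient space\<close>

text \<open>The polar form of the energy. Written with differences it is visibly unaffected by
  adding constants, and it is symmetric even when the Laplacian is not.\<close>

lift_definition energy :: "real^'n^'n \<Rightarrow> real^'n \<Rightarrow> 'n ones_quotient \<Rightarrow> 'n ones_quotient \<Rightarrow> real"
  is "\<lambda>P w x y. (\<Sum>i\<in>UNIV. \<Sum>j\<in>UNIV.
        w $ i * P $ i $ j * ((x $ i - x $ j) * (y $ i - y $ j))) / 2"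
proof -
  fix P :: "real^'n^'n" and w x x' y y' :: "real^'n"
  have diff: "u $ i - u $ j = v $ i - v $ j" if span: "u - v \<in> span {vec 1}" for u v :: "real^'n" and i j
  proof -
    obtain c where "u - v = c *\<^sub>R vec 1"
      using span unfolding span_singleton by blast
    then have "(u - v) $ i = c" "(u - v) $ j = c"
      by simp_all
    then show ?thesis by simp
  qed
  assume "x - x' \<in> span {vec 1}" "y - y' \<in> span {vec 1}"
  then show "(\<Sum>i\<in>UNIV. \<Sum>j\<in>UNIV. w $ i * P $ i $ j * ((x $ i - x $ j) * (y $ i - y $ j))) / 2 =
      (\<Sum>i\<in>UNIV. \<Sum>j\<in>UNIV. w $ i * P $ i $ j * ((x' $ i - x' $ j) * (y' $ i - y' $ j))) / 2"
    by (simp add: diff[of x x'] diff[of y y'])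
qed

lemma energy_commute: "energy P w X Y = energy P w Y X"
  by transfer (simp add: mult.commute)

lemma energy_add_left: "energy P w (X + X') Y = energy P w X Y + energy P w X' Y"
  by transfer
    (simp add: algebra_simps sum.distrib sum_subtractf add_divide_distrib diff_divide_distrib)

lemma energy_scaleR_left: "energy P w (c *\<^sub>R X) Y = c * energy P w X Y"
proof transfer
  fix P :: "real^'n^'n" and w x y :: "real^'n" and c
  have "w $ i * P $ i $ j * (((c *\<^sub>R x) $ i - (c *\<^sub>R x) $ j) * (y $ i - y $ j)) =
      c * (w $ i * P $ i $ j * ((x $ i - x $ j) * (y $ i - y $ j)))" for i j
    unfolding vector_scaleR_component real_scaleR_def by algebra
  then show "(\<Sum>i\<in>UNIV. \<Sum>j\<in>UNIV.
        w $ i * P $ i $ j * (((c *\<^sub>R x) $ i - (c *\<^sub>R x) $ j) * (y $ i - y $ j))) / 2 =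
      c * ((\<Sum>i\<in>UNIV. \<Sum>j\<in>UNIV. w $ i * P $ i $ j * ((x $ i - x $ j) * (y $ i - y $ j))) / 2)"
    by (simp only: sum_distrib_left[symmetric] times_divide_eq_right)
qed

lemma bilinear_energy: "bilinear (energy P w)"
  unfolding bilinear_def
proof (intro conjI allI linearI)
  show "energy P w X (Y + Y') = energy P w X Y + energy P w X Y'" for X Y Y'
    by (metis energy_add_left energy_commute)
  show "energy P w X (c *\<^sub>R Y) = c *\<^sub>R energy P w X Y" for X Y c
    by (metis energy_scaleR_left energy_commute real_scaleR_def)
qed (simp_all add: energy_add_left energy_scaleR_left)

lemma quotient_class_surj: "\<exists>x. X = quotient_class x"
  by transfer (metis diff_self span_zero)

lemma quotient_class_eq_0_iff: "quotient_class x = 0 \<longleftrightarrow> x \<in> span {vec 1}"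
  by transfer simp

lemma quotient_class_diff: "quotient_class x - quotient_class y = quotient_class (x - y)"
  by transfer (simp add: span_zero)

theorem mainTheorem1:
  fixes P :: "real^'n^'n" and w :: "real^'n"
  assumes "stochastic_matrix P" and "ergodic P" and "equilibrium_distribution P w"
  shows "\<exists>!q :: 'n ones_quotient \<Rightarrow> real.
           (\<forall>x. q (quotient_class x) = laplacian_form P w x) \<and>
           quadratic_form q \<and> positive_definite q \<and>
           (\<forall>a b. ennreal (q (embedding P w a - embedding P w b)) = commuting_time P a b)"
proof -
  interpret irreducible_chain P w
    by (rule irreducible_chain.intro[OF assms])
  define q where "q X = energy P w X X" for X
  have q_class: "q (quotient_class x) = laplacian_form P w x" for x
    unfolding q_def laplacian_form_eq_energy by transfer (simp add: power2_eq_square)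
  have "quadratic_form q"
    unfolding quadratic_form_def q_def using bilinear_energy energy_commute by blast
  moreover have "positive_definite q"
    unfolding positive_definite_def
  proof (intro allI impI)
    fix X :: "'n ones_quotient"
    assume "X \<noteq> 0"
    obtain x where X: "X = quotient_class x"
      using quotient_class_surj by blast
    then have "laplacian_form P w x \<noteq> 0"
      using \<open>X \<noteq> 0\<close> laplacian_form_eq_0_imp_const quotient_class_eq_0_iff by blast
    then show "0 < q X"
      using laplacian_form_nonneg[of x] by (simp add: X q_class)
  qed
  moreover have "ennreal (q (embedding P w a - embedding P w b)) = commuting_time P a b" for a b
  proof -
    have "embedding P w a - embedding P w b =
        quotient_class (\<chi> j. Z_lower P w $ a $ j - Z_lower P w $ b $ j)"
      unfolding embedding_def quotient_class_diff
      by (rule arg_cong[where f = quotient_class]) (simp add: vec_eq_iff)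
    then show ?thesis
      by (simp only: q_class laplacian_form_potential commuting_time_def expected_hitting_time_eq
          ennreal_plus[OF hitting_potential_nonneg hitting_potential_nonneg])
  qed
  \<comment> \<open>Uniqueness needs only the values on classes, since every element of the quotient
    is a class.\<close>
  ultimately show ?thesis
  proof (intro ex1I[of _ q] conjI allI q_class)
    fix q' :: "'n ones_quotient \<Rightarrow> real"
    assume "(\<forall>x. q' (quotient_class x) = laplacian_form P w x) \<and>
        quadratic_form q' \<and> positive_definite q' \<and>
        (\<forall>a b. ennreal (q' (embedding P w a - embedding P w b)) = commuting_time P a b)"
    then show "q' = q"
      using q_class quotient_class_surj by (metis ext)
  qed blast+
qed

end
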